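(* Let $n\geq 2$ and $1\leq m\leq \lceil\frac{n}{2}\rceil\lfloor\frac{n}{2}\rfloor$ be integers, and let $G$ be a bipartite graph with $n$ vertices and $m$ edges. Then $$I_{d}(G)\geq 1+\log\sqrt{m},$$ and equality holds if and only if $G\cong K_{q,b}\cup \overline{K}_{n-q-b}$ for some positive integers $q$ and $b$ satisfying $qb=m$ and $q+b\leq n$.
   Context: All graphs are simple, finite and undirected. Logarithms are base $2$, with the convention $0\log 0=0$. For a graph $G$ with vertices $v_1,\dots,v_n$, at least one edge, and degrees $d_G(v_i)$, the degree-based entropy is $$I_d(G)=-\sum_{i=1}^{n}\frac{d_G(v_i)}{\sum_{j=1}^n d_G(v_j)}\log\frac{d_G(v_i)}{\sum_{j=1}^n d_G(v_j)}.$$ $K_{q,b}$ is the complete bipartite graph with parts of sizes $q$ and $b$; $\overline{K}_r$ is the graph with $r$ vertices and no edges (the empty graph if $r=0$); $G\cup H$ denotes the (vertex-disjoint) union of graphs. *)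

theory Defs
  imports Complex_Main "Graph_Theory.Graph_Theory"
begin

text \<open>
  A finite simple undirected graph is a \<^locale>\<open>pair_graph\<close>: a finite vertex set with a symmetric
  irreflexive arc relation. Every undirected edge is therefore represented by two opposite arcs,
  so the number of edges is the number of unordered end pairs, while the degree of a vertex
  is its \<^const>\<open>out_degree\<close>.
\<close>

definition edges :: "'a pair_pre_digraph \<Rightarrow> 'a set set" where
  "edges G = {{u, v} | u v. (u, v) \<in> parcs G}"

definition bipartite :: "'a pair_pre_digraph \<Rightarrow> bool" where
  "bipartite G \<longleftrightarrow>
    (\<exists>U W. pverts G = U \<union> W \<and> U \<inter> W = {} \<and> parcs G \<subseteq> U \<times> W \<union> W \<times> U)"

text \<open>Isolated vertices contribute \<open>0 * log 2 0 = 0\<close>.\<close>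

definition degree_entropy :: "'a pair_pre_digraph \<Rightarrow> real" where
  "degree_entropy G =
    - (\<Sum>v\<in>pverts G.
        real (out_degree (with_proj G) v) / (\<Sum>u\<in>pverts G. real (out_degree (with_proj G) u)) *
        log 2 (real (out_degree (with_proj G) v) /
          (\<Sum>u\<in>pverts G. real (out_degree (with_proj G) u))))"

definition complete_bipartite_graph :: "nat \<Rightarrow> nat \<Rightarrow> (nat + nat) pair_pre_digraph" where
  "complete_bipartite_graph q b =
    \<lparr> pverts = Inl ` {..<q} \<union> Inr ` {..<b},
      parcs = (Inl ` {..<q}) \<times> (Inr ` {..<b}) \<union> (Inr ` {..<b}) \<times> (Inl ` {..<q}) \<rparr>"

definition edgeless_graph :: "nat \<Rightarrow> nat pair_pre_digraph" where
  "edgeless_graph r = \<lparr> pverts = {..<r}, parcs = {} \<rparr>"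

definition disjoint_union ::
  "'a pair_pre_digraph \<Rightarrow> 'b pair_pre_digraph \<Rightarrow> ('a + 'b) pair_pre_digraph" where
  "disjoint_union G H =
    \<lparr> pverts = Inl ` pverts G \<union> Inr ` pverts H,
      parcs = map_prod Inl Inl ` parcs G \<union> map_prod Inr Inr ` parcs H \<rparr>"

lemma complete_bipartite_graph_is_K:
  "complete_bipartite_digraph q b (with_proj (complete_bipartite_graph q b))"
  unfolding complete_bipartite_digraph_pair_def
proof (intro conjI exI)
  show "finite (pverts (complete_bipartite_graph q b))"
    by (simp add: complete_bipartite_graph_def)
  show "pverts (complete_bipartite_graph q b) = Inl ` {..<q} \<union> Inr ` {..<b}"
    by (simp add: complete_bipartite_graph_def)
qed (auto simp: complete_bipartite_graph_def card_image)

lemma pair_graph_complete_bipartite_graph: "pair_graph (complete_bipartite_graph q b)"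
  by unfold_locales (auto simp: complete_bipartite_graph_def symmetric_def sym_def)

lemma pair_graph_edgeless_graph: "pair_graph (edgeless_graph r)"
  by unfold_locales (auto simp: edgeless_graph_def symmetric_def sym_def)

lemma pair_graph_disjoint_union:
  assumes "pair_graph G" and "pair_graph H"
  shows "pair_graph (disjoint_union G H)"
proof -
  interpret G: pair_graph G by (fact assms)
  interpret H: pair_graph H by (fact assms)
  have "sym (parcs G)" "sym (parcs H)"
    using G.sym_arcs H.sym_arcs by (simp_all add: symmetric_def)
  then have "sym (parcs (disjoint_union G H))"
    by (auto simp: disjoint_union_def sym_def)
  then show ?thesis
    by unfold_locales
      (auto simp: disjoint_union_def symmetric_def dest: G.in_arcsD1 G.in_arcsD2
        H.in_arcsD1 H.in_arcsD2 G.pair_no_loops H.pair_no_loops)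
qed

end

theory Submission
  imports Defs
begin

text \<open>
  Pick an edge of the bipartite graph uniformly at random and let \<open>X\<close> and \<open>Y\<close> be its ends in the
  two parts. The law of \<open>X\<close> is \<open>d(u) / m\<close> and that of \<open>Y\<close> is \<open>d(w) / m\<close>, so the degree-based entropy
  is \<open>1 + (H(X) + H(Y)) / 2\<close>, while \<open>H(X, Y) = log m\<close>. The bound is therefore subadditivity of
  entropy, and equality means that \<open>X\<close> and \<open>Y\<close> are independent: every non-isolated vertex of one
  part is adjacent to every non-isolated vertex of the other.
\<close>

section \<open>Row and column counts of a finite relation, and subadditivity of entropy\<close>

lemma sum_relation_fst:
  fixes g :: "'a \<Rightarrow> real"
  assumes "finite U" "finite W" "E \<subseteq> U \<times> W"
  shows "(\<Sum>(u, w)\<in>E. g u) = (\<Sum>u\<in>U. card (E `` {u}) * g u)"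
proof -
  have "E = Sigma U (\<lambda>u. E `` {u})" using assms by auto
  moreover have "\<forall>u\<in>U. finite (E `` {u})"
    using assms by (meson Image_singleton_iff SigmaD2 finite_subset subsetD subsetI)
  ultimately have "(\<Sum>(u, w)\<in>E. g u) = (\<Sum>u\<in>U. \<Sum>w\<in>E `` {u}. g u)"
    using sum.Sigma[OF assms(1), of "\<lambda>u. E `` {u}" "\<lambda>u w. g u"] by simp
  then show ?thesis by simp
qed

text \<open>Passing to the converse relation turns columns into rows. With \<open>g\<close>
  constantly 1, this and the row version count the pairs of \<open>E\<close>; with \<open>g\<close>
  the logarithm of a degree, they turn sums over edges into sums of the form d ln d over
  vertices.\<close>

lemma sum_relation_snd:
  fixes g :: "'b \<Rightarrow> real"
  assumes "finite U" "finite W" "E \<subseteq> U \<times> W"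
  shows "(\<Sum>(u, w)\<in>E. g w) = (\<Sum>w\<in>W. card (E\<inverse> `` {w}) * g w)"
proof -
  have "E\<inverse> = prod.swap ` E" by auto
  then have "(\<Sum>(u, w)\<in>E. g w) = (\<Sum>(w, u)\<in>E\<inverse>. g w)"
    by (simp add: sum.reindex case_prod_unfold)
  also have "\<dots> = (\<Sum>w\<in>W. card (E\<inverse> `` {w}) * g w)"
    using assms by (intro sum_relation_fst[of W U]) auto
  finally show ?thesis .
qed

text \<open>Both sides equal \<open>m\<close> times the Kullback-Leibler divergence of the uniform
  law on \<open>E\<close> from the product of its marginals. The right side is arranged so that
  every summand is nonnegative: with x = \<open>r u * c w / m\<close>, a pair of \<open>E\<close>
  contributes x - 1 - ln x, and a pair outside \<open>E\<close> contributes x.\<close>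

lemma relation_entropy_gap:
  fixes E :: "('a \<times> 'b) set"
  assumes fin: "finite U" "finite W" and E: "E \<subseteq> U \<times> W" "E \<noteq> {}"
  defines "r \<equiv> \<lambda>u. real (card (E `` {u}))"
    and "c \<equiv> \<lambda>w. real (card (E\<inverse> `` {w}))"
    and "m \<equiv> real (card E)"
  shows "m * ln m - ((\<Sum>u\<in>U. r u * ln (r u)) + (\<Sum>w\<in>W. c w * ln (c w))) =
    (\<Sum>(u, w)\<in>E. r u * c w / m - 1 - ln (r u * c w / m)) +
    (\<Sum>(u, w)\<in>U \<times> W - E. r u * c w / m)"
proof -
  have finE: "finite E" using fin E finite_subset by blast
  then have m: "m > 0" using E by (simp add: m_def card_gt_0_iff)
  have pos: "r u > 0" "c w > 0" if "(u, w) \<in> E" for u w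
    using that finE by (auto simp: r_def c_def card_gt_0_iff)
  have sums: "(\<Sum>u\<in>U. r u) = m" "(\<Sum>w\<in>W. c w) = m"
    using sum_relation_fst[OF fin E(1), of "\<lambda>_. 1"] sum_relation_snd[OF fin E(1), of "\<lambda>_. 1"]
    by (simp_all add: r_def c_def m_def)
  have "(\<Sum>(u, w)\<in>U \<times> W. r u * c w / m) = (\<Sum>u\<in>U. r u) * (\<Sum>w\<in>W. c w) / m"
    by (simp add: sum_product sum.cartesian_product sum_divide_distrib case_prod_unfold)
  then have "(\<Sum>(u, w)\<in>U \<times> W. r u * c w / m) = m"
    using m sums by simp
  \<comment> \<open>The products \<open>r u * c w / m\<close> have total \<open>m\<close> on the
    whole grid, just like the constant 1 on \<open>E\<close>. Inserting x - 1 into the terms over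
    \<open>E\<close> is thus balanced exactly by the sum of x over the complement.\<close>
  then have split: "(\<Sum>(u, w)\<in>U \<times> W - E. r u * c w / m) + (\<Sum>(u, w)\<in>E. r u * c w / m) = m"
    using sum.subset_diff[OF E(1), of "\<lambda>(u, w). r u * c w / m"] fin by simp
  have "(\<Sum>(u, w)\<in>E. r u * c w / m - 1 - ln (r u * c w / m)) =
    (\<Sum>(u, w)\<in>E. r u * c w / m - 1 + ln m - ln (r u) - ln (c w))"
    using pos m by (intro sum.cong) (auto simp: ln_div ln_mult less_imp_neq[symmetric])
  also have "\<dots> = (\<Sum>(u, w)\<in>E. r u * c w / m) - m + m * ln m
      - (\<Sum>(u, w)\<in>E. ln (r u)) - (\<Sum>(u, w)\<in>E. ln (c w))"
    by (simp add: case_prod_unfold sum_subtractf sum.distrib m_def)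
  also have "(\<Sum>(u, w)\<in>E. ln (r u)) = (\<Sum>u\<in>U. r u * ln (r u))"
    unfolding r_def by (rule sum_relation_fst[OF fin E(1)])
  also have "(\<Sum>(u, w)\<in>E. ln (c w)) = (\<Sum>w\<in>W. c w * ln (c w))"
    unfolding c_def by (rule sum_relation_snd[OF fin E(1)])
  finally show ?thesis using split by simp
qed

text \<open>The gap is nonnegative because ln x is at most x - 1. If it is zero, its part outside
  \<open>E\<close> vanishes, so no pair outside \<open>E\<close> has both a nonempty row and a
  nonempty column, which makes \<open>E\<close> a full product. For a full product, x = 1 on
  \<open>E\<close> and x = 0 elsewhere.\<close>

lemma relation_entropy_le:
  fixes E :: "('a \<times> 'b) set"
  assumes fin: "finite U" "finite W" and E: "E \<subseteq> U \<times> W" "E \<noteq> {}"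
  defines "S \<equiv> (\<Sum>u\<in>U. card (E `` {u}) * ln (card (E `` {u}))) +
    (\<Sum>w\<in>W. card (E\<inverse> `` {w}) * ln (card (E\<inverse> `` {w})))"
  shows "S \<le> card E * ln (card E)"
    and "S = card E * ln (card E) \<longleftrightarrow> E = Domain E \<times> Range E"
proof -
  define r where "r u = real (card (E `` {u}))" for u
  define c where "c w = real (card (E\<inverse> `` {w}))" for w
  define m where "m = real (card E)"
  have finE: "finite E" using fin E finite_subset by blast
  then have m: "m > 0" using E by (simp add: m_def card_gt_0_iff)
  have r: "r u > 0" if "u \<in> Domain E" for u
    using that finE by (auto simp: r_def card_gt_0_iff)
  have c: "c w > 0" if "w \<in> Range E" for w
    using that finE by (auto simp: c_def card_gt_0_iff)
  have r0: "r u = 0" if "u \<notin> Domain E" for u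
  proof -
    have "E `` {u} = {}" using that by auto
    then show ?thesis by (simp add: r_def)
  qed
  have c0: "c w = 0" if "w \<notin> Range E" for w
  proof -
    have "E\<inverse> `` {w} = {}" using that by auto
    then show ?thesis by (simp add: c_def)
  qed
  have gap: "m * ln m - S =
    (\<Sum>(u, w)\<in>E. r u * c w / m - 1 - ln (r u * c w / m)) +
    (\<Sum>(u, w)\<in>U \<times> W - E. r u * c w / m)" (is "_ = ?D + ?N")
    using relation_entropy_gap[OF fin E] by (simp add: r_def c_def m_def S_def)
  have D: "?D \<ge> 0"
  proof (rule sum_nonneg, clarify)
    fix u w assume "(u, w) \<in> E"
    then have "r u > 0" "c w > 0" using r c by auto
    then have "r u * c w / m > 0" using m by simp
    from ln_le_minus_one[OF this] show "0 \<le> r u * c w / m - 1 - ln (r u * c w / m)" by simp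
  qed
  have N: "?N \<ge> 0" by (intro sum_nonneg) (auto simp: r_def c_def m_def)
  show "S \<le> card E * ln (card E)" using gap D N by (simp add: m_def)
  show "S = card E * ln (card E) \<longleftrightarrow> E = Domain E \<times> Range E"
  proof
    assume "S = card E * ln (card E)"
    then have "?N = 0" using gap D N by (simp add: m_def)
    moreover have "finite (U \<times> W - E)" using fin by simp
    ultimately have zero: "\<forall>p\<in>U \<times> W - E. (case p of (u, w) \<Rightarrow> r u * c w / m) = 0"
      by (subst (asm) sum_nonneg_eq_0_iff) (auto simp: r_def c_def m_def)
    have "(u, w) \<in> E" if "u \<in> Domain E" "w \<in> Range E" for u w
    proof (rule ccontr)
      assume "(u, w) \<notin> E"
      moreover have "u \<in> U" "w \<in> W" using that E by auto
      ultimately have "r u * c w / m = 0" using bspec[OF zero, of "(u, w)"] by simp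
      then show False using r[OF that(1)] c[OF that(2)] m by simp
    qed
    then show "E = Domain E \<times> Range E" by auto
  next
    \<comment> \<open>In a product relation each nonempty row is the whole range and each nonempty
      column the whole domain, so the row and column counts at a pair of \<open>E\<close> multiply
      to \<open>m\<close>.\<close>
    assume eq: "E = Domain E \<times> Range E"
    have m': "m = card (Domain E) * card (Range E)"
      using arg_cong[OF eq, of card] by (simp add: m_def card_cartesian_product)
    have rr: "r u = card (Range E)" if "u \<in> Domain E" for u
    proof -
      have "E `` {u} = Range E" using that eq by blast
      then show ?thesis by (simp add: r_def)
    qed
    have cc: "c w = card (Domain E)" if "w \<in> Range E" for w
    proof -
      have "E\<inverse> `` {w} = Domain E" using that eq by blast
      then show ?thesis by (simp add: c_def)
    qed
    have one: "r u * c w / m = 1" if "(u, w) \<in> E" for u w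
    proof -
      have "r u * c w = m"
        using rr[OF DomainI[OF that]] cc[OF RangeI[OF that]] m' by simp
      then show ?thesis using m by simp
    qed
    have "?D = 0" by (intro sum.neutral) (clarsimp simp only: one split_conv, simp)
    \<comment> \<open>A pair outside the product misses the domain or the range, so one of the two
      counts is zero.\<close>
    moreover have "?N = 0"
      using eq r0 c0 by (intro sum.neutral) fastforce
    ultimately show "S = card E * ln (card E)" using gap by (simp add: m_def)
  qed
qed

section \<open>Degree-based entropy of a bipartite graph\<close>

lemma out_degree_with_proj: "out_degree (with_proj G) v = card (parcs G `` {v})"
proof -
  have "out_arcs (with_proj G) v = Pair v ` (parcs G `` {v})"
    by (auto simp: out_arcs_def)
  then show ?thesis by (simp add: out_degree_def card_image inj_on_def)
qed

text \<open>Orienting every edge from \<open>U\<close> to \<open>W\<close> represents it by exactly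
  one pair of \<open>E\<close>. Degrees in \<open>U\<close> are then row counts, degrees in
  \<open>W\<close> are column counts, and the degrees sum to twice the number of edges. Natural
  logarithms inside the sums match the form of the relation inequality.\<close>

lemma degree_entropy_bipartition:
  assumes "pair_graph G" and V: "pverts G = U \<union> W" "U \<inter> W = {}"
    and arcs: "parcs G \<subseteq> U \<times> W \<union> W \<times> U" and "edges G \<noteq> {}"
  defines "E \<equiv> parcs G \<inter> U \<times> W"
  shows "card E = card (edges G)" and "E \<noteq> {}"
    and "degree_entropy G = 1 + log 2 (card E) -
      ((\<Sum>u\<in>U. card (E `` {u}) * ln (card (E `` {u}))) +
       (\<Sum>w\<in>W. card (E\<inverse> `` {w}) * ln (card (E\<inverse> `` {w})))) / (2 * card E * ln 2)"
proof -
  interpret G: pair_graph G by fact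
  have fin: "finite U" "finite W" using G.pair_finite_verts V by auto
  have finE: "finite E" using G.pair_finite_arcs by (simp add: E_def)
  have sub: "E \<subseteq> U \<times> W" by (simp add: E_def)
  have img: "edges G = (\<lambda>(u, w). {u, w}) ` E"
  proof
    show "edges G \<subseteq> (\<lambda>(u, w). {u, w}) ` E"
    proof
      fix e assume "e \<in> edges G"
      then obtain u v where e: "e = {u, v}" "(u, v) \<in> parcs G" by (auto simp: edges_def)
      then have "(u, v) \<in> E \<or> (v, u) \<in> E" using arcs G.arcs_symmetric by (auto simp: E_def)
      then show "e \<in> (\<lambda>(u, w). {u, w}) ` E" using e by (force simp: insert_commute)
    qed
  qed (auto simp: edges_def E_def)
  \<comment> \<open>Since \<open>U\<close> and \<open>W\<close> are disjoint, the unordered pair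
    determines which end is the first one.\<close>
  have "inj_on (\<lambda>(u, w). {u, w}) E"
    using V by (auto simp: inj_on_def E_def doubleton_eq_iff)
  then show card: "card E = card (edges G)" using img by (simp add: card_image)
  show ne: "E \<noteq> {}" using img \<open>edges G \<noteq> {}\<close> by auto
  define m where "m = real (card E)"
  have m: "m > 0" using ne finE by (simp add: m_def card_gt_0_iff)
  define d where "d v = real (out_degree (with_proj G) v)" for v
  have dU: "d u = card (E `` {u})" if "u \<in> U" for u
  proof -
    have "parcs G `` {u} = E `` {u}" using that arcs V by (auto simp: E_def)
    then show ?thesis by (simp add: d_def out_degree_with_proj)
  qed
  \<comment> \<open>By symmetry, the arcs leaving a vertex of \<open>W\<close> are the reversals of
    the pairs of \<open>E\<close> entering it.\<close>
  have dW: "d w = card (E\<inverse> `` {w})" if "w \<in> W" for w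
  proof -
    have "parcs G `` {w} = E\<inverse> `` {w}"
      using that arcs V G.arcs_symmetric by (auto simp: E_def)
    then show ?thesis by (simp add: d_def out_degree_with_proj)
  qed
  have "sum d U = m"
    using sum_relation_fst[OF fin sub, of "\<lambda>_. 1"] by (simp add: m_def dU)
  moreover have "sum d W = m"
    using sum_relation_snd[OF fin sub, of "\<lambda>_. 1"] by (simp add: m_def dW)
  ultimately have total: "sum d (pverts G) = 2 * m"
    using V fin by (simp add: sum.union_disjoint)
  \<comment> \<open>At an isolated vertex the factor \<open>d v\<close> annihilates both sides, in
    accordance with 0 log 0 = 0; elsewhere the logarithm of the quotient splits.\<close>
  have summand: "d v / (2 * m) * log 2 (d v / (2 * m)) =
      d v * ln (d v) / (2 * m * ln 2) - d v * (log 2 (2 * m) / (2 * m))" for v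
  proof (cases "d v = 0")
    case False
    then have "d v > 0" by (simp add: d_def)
    then have "log 2 (d v / (2 * m)) = ln (d v) / ln 2 - log 2 (2 * m)"
      using m by (simp add: log_divide) (simp add: log_def)
    then show ?thesis by (simp add: right_diff_distrib)
  qed simp
  have "degree_entropy G = - (\<Sum>v\<in>pverts G. d v / (2 * m) * log 2 (d v / (2 * m)))"
    using total by (simp add: degree_entropy_def d_def)
  also have "\<dots> = sum d (pverts G) * (log 2 (2 * m) / (2 * m)) -
      (\<Sum>v\<in>pverts G. d v * ln (d v)) / (2 * m * ln 2)"
    unfolding summand
    by (simp only: sum_subtractf sum_distrib_right[symmetric] sum_divide_distrib[symmetric]
          minus_diff_eq)
  \<comment> \<open>The summand 1 of the bound is log 2, coming from the degree sum
    \<open>2 * m\<close>.\<close>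
  also have "sum d (pverts G) * (log 2 (2 * m) / (2 * m)) = 1 + log 2 m"
    using total m by (simp add: log_mult)
  also have "(\<Sum>v\<in>pverts G. d v * ln (d v)) = (\<Sum>u\<in>U. d u * ln (d u)) + (\<Sum>w\<in>W. d w * ln (d w))"
    using V fin by (simp add: sum.union_disjoint)
  finally show "degree_entropy G = 1 + log 2 (card E) -
      ((\<Sum>u\<in>U. card (E `` {u}) * ln (card (E `` {u}))) +
       (\<Sum>w\<in>W. card (E\<inverse> `` {w}) * ln (card (E\<inverse> `` {w})))) / (2 * card E * ln 2)"
    by (simp add: dU dW m_def)
qed

text \<open>The entropy exceeds the bound by \<open>(m * ln m - S) / (2 * m * ln 2)\<close>, where
  \<open>S\<close> is the sum of d ln d over all vertices. Both claims are therefore the relation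
  inequality and its equality case, up to a positive factor.\<close>

lemma degree_entropy_bipartition_ge:
  assumes G: "pair_graph G" and V: "pverts G = U \<union> W" "U \<inter> W = {}"
    and arcs: "parcs G \<subseteq> U \<times> W \<union> W \<times> U" and ne: "edges G \<noteq> {}"
  defines "E \<equiv> parcs G \<inter> U \<times> W" and "m \<equiv> card (edges G)"
  shows "degree_entropy G \<ge> 1 + log 2 (sqrt m)"
    and "degree_entropy G = 1 + log 2 (sqrt m) \<longleftrightarrow> E = Domain E \<times> Range E"
proof -
  interpret G: pair_graph G by fact
  note bip = degree_entropy_bipartition[OF G V arcs ne, folded E_def]
  define S where "S = (\<Sum>u\<in>U. card (E `` {u}) * ln (card (E `` {u}))) +
       (\<Sum>w\<in>W. card (E\<inverse> `` {w}) * ln (card (E\<inverse> `` {w})))"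
  have fin: "finite U" "finite W" using G.pair_finite_verts V by auto
  have sub: "E \<subseteq> U \<times> W" by (simp add: E_def)
  have m: "card E = m" using bip(1) by (simp add: m_def)
  have "finite E" using G.pair_finite_arcs by (simp add: E_def)
  then have pos: "m > 0" using bip(2) m by (auto simp: card_gt_0_iff)
  have "log 2 (sqrt m) = ln m / (2 * ln 2)"
    using pos by (simp add: log_def ln_sqrt)
  then have gap: "degree_entropy G - (1 + log 2 (sqrt m)) = (m * ln m - S) / (2 * m * ln 2)"
    using pos bip(3)[folded S_def] m by (simp add: log_def field_simps)
  note le = relation_entropy_le[OF fin sub bip(2), folded S_def, unfolded m]
  have "(m * ln m - S) / (2 * m * ln 2) \<ge> 0" using le(1) by simp
  then show "degree_entropy G \<ge> 1 + log 2 (sqrt m)" using gap by linarith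
  have "(m * ln m - S) / (2 * m * ln 2) = 0 \<longleftrightarrow> S = m * ln m" using pos by auto
  then show "degree_entropy G = 1 + log 2 (sqrt m) \<longleftrightarrow> E = Domain E \<times> Range E"
    using gap le(2) by linarith
qed

section \<open>Isomorphism with a complete bipartite graph plus isolated vertices\<close>

lemma digraph_iso_with_proj_iff:
  assumes "pair_wf_digraph G"
  shows "digraph_iso (with_proj G) (with_proj H) \<longleftrightarrow>
    (\<exists>f. inj_on f (pverts G) \<and> pverts H = f ` pverts G \<and> parcs H = map_prod f f ` parcs G)"
proof
  assume "digraph_iso (with_proj G) (with_proj H)"
  then obtain h where h: "pre_digraph.digraph_isomorphism (with_proj G) h"
    and H: "with_proj H = app_iso h (with_proj G)" by (auto simp: digraph_iso_def)
  \<comment> \<open>Tail and head in \<open>with_proj H\<close> are the two projections, so the arc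
    map of \<open>h\<close> must act on both coordinates as the vertex map does.\<close>
  have H': "pverts H = iso_verts h ` pverts G" "parcs H = iso_arcs h ` parcs G"
      "iso_tail h = fst" "iso_head h = snd"
    using H by (simp_all add: with_proj_def app_iso_def)
  have "iso_arcs h a = map_prod (iso_verts h) (iso_verts h) a" if "a \<in> parcs G" for a
    using h that H' by (auto simp: pre_digraph.digraph_isomorphism_def prod_eq_iff)
  then have "parcs H = map_prod (iso_verts h) (iso_verts h) ` parcs G" using H' by auto
  moreover have "inj_on (iso_verts h) (pverts G)"
    using h by (auto simp: pre_digraph.digraph_isomorphism_def)
  ultimately show "\<exists>f. inj_on f (pverts G) \<and> pverts H = f ` pverts G \<and>
      parcs H = map_prod f f ` parcs G" using H' by blast
next
  interpret G: pair_wf_digraph G by fact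
  assume "\<exists>f. inj_on f (pverts G) \<and> pverts H = f ` pverts G \<and> parcs H = map_prod f f ` parcs G"
  then obtain f where f: "inj_on f (pverts G)" "pverts H = f ` pverts G"
    "parcs H = map_prod f f ` parcs G" by blast
  define h where "h = \<lparr> iso_verts = f, iso_arcs = map_prod f f, iso_head = snd, iso_tail = fst \<rparr>"
  have "inj_on (map_prod f f) (parcs G)"
  proof (rule inj_on_subset)
    show "inj_on (map_prod f f) (pverts G \<times> pverts G)" using f(1) by (intro map_prod_inj_on)
    show "parcs G \<subseteq> pverts G \<times> pverts G" by (auto dest: G.in_arcsD1 G.in_arcsD2)
  qed
  then have "pre_digraph.digraph_isomorphism (with_proj G) h"
    using f G.wf_digraph_axioms by (simp add: pre_digraph.digraph_isomorphism_def h_def)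
  moreover have "with_proj H = app_iso h (with_proj G)"
    using f by (simp add: with_proj_def app_iso_def h_def)
  ultimately show "digraph_iso (with_proj G) (with_proj H)" by (auto simp: digraph_iso_def)
qed

lemma pverts_complete_bipartite_union:
  "pverts (disjoint_union (complete_bipartite_graph q b) (edgeless_graph k)) =
    (Inl \<circ> Inl) ` {..<q} \<union> (Inl \<circ> Inr) ` {..<b} \<union> Inr ` {..<k}"
  by (auto simp: disjoint_union_def complete_bipartite_graph_def edgeless_graph_def)

lemma parcs_complete_bipartite_union:
  "parcs (disjoint_union (complete_bipartite_graph q b) (edgeless_graph k)) =
    (Inl \<circ> Inl) ` {..<q} \<times> (Inl \<circ> Inr) ` {..<b} \<union> (Inl \<circ> Inr) ` {..<b} \<times> (Inl \<circ> Inl) ` {..<q}"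
  by (force simp: disjoint_union_def complete_bipartite_graph_def edgeless_graph_def)

text \<open>This replaces the concrete sum type by a condition inside \<open>G\<close>. The sets
  \<open>A\<close> and \<open>B\<close> are the preimages of the two sides; the cardinality equation
  leaves exactly \<open>k\<close> vertices for the edgeless part. Conversely, bijections on
  \<open>A\<close>, on \<open>B\<close> and on the remaining vertices glue together.\<close>

lemma digraph_iso_complete_bipartite_union_iff:
  assumes "pair_graph G"
  shows "digraph_iso (with_proj G)
      (with_proj (disjoint_union (complete_bipartite_graph q b) (edgeless_graph k))) \<longleftrightarrow>
    (\<exists>A B. A \<subseteq> pverts G \<and> B \<subseteq> pverts G \<and> A \<inter> B = {} \<and> card A = q \<and> card B = b \<and>
      card (pverts G) = q + b + k \<and> parcs G = A \<times> B \<union> B \<times> A)" (is "?L \<longleftrightarrow> ?R")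
proof -
  interpret G: pair_graph G by fact
  note iff = digraph_iso_with_proj_iff[OF G.pair_wf_digraph_axioms]
  define Q :: "((nat + nat) + nat) set" where "Q = (Inl \<circ> Inl) ` {..<q}"
  define R :: "((nat + nat) + nat) set" where "R = (Inl \<circ> Inr) ` {..<b}"
  define K :: "((nat + nat) + nat) set" where "K = Inr ` {..<k}"
  have cards: "card Q = q" "card R = b" "card K = k"
    by (simp_all add: Q_def R_def K_def card_image inj_on_def)
  have fin: "finite Q" "finite R" "finite K" by (simp_all add: Q_def R_def K_def)
  have disj: "Q \<inter> R = {}" "Q \<inter> K = {}" "R \<inter> K = {}" by (auto simp: Q_def R_def K_def)
  show ?thesis
  proof
    assume ?L
    then obtain f where inj: "inj_on f (pverts G)" and verts: "f ` pverts G = Q \<union> R \<union> K"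
      and arcs: "map_prod f f ` parcs G = Q \<times> R \<union> R \<times> Q"
      unfolding iff pverts_complete_bipartite_union parcs_complete_bipartite_union
      by (auto simp: Q_def R_def K_def)
    define A where "A = {v \<in> pverts G. f v \<in> Q}"
    define B where "B = {v \<in> pverts G. f v \<in> R}"
    have img: "f ` A = Q" "f ` B = R" using verts by (auto simp: A_def B_def)
    have sub: "A \<subseteq> pverts G" "B \<subseteq> pverts G" by (auto simp: A_def B_def)
    have "card A = q" "card B = b"
      using img sub inj cards by (metis card_image inj_on_subset)+
    moreover have "card (pverts G) = q + b + k"
    proof -
      have "card (pverts G) = card (Q \<union> R \<union> K)" using inj verts by (metis card_image)
      also have "\<dots> = q + b + k"
        using fin disj cards by (simp add: card_Un_disjoint Int_Un_distrib2)
      finally show ?thesis .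
    qed
    moreover have "parcs G = A \<times> B \<union> B \<times> A"
    proof (rule set_eqI, clarify)
      fix u v
      \<comment> \<open>Injectivity of \<open>f\<close> on the vertices lets adjacency be tested on
        images.\<close>
      have "(u, v) \<in> parcs G \<longleftrightarrow> (f u, f v) \<in> map_prod f f ` parcs G"
        if "u \<in> pverts G" "v \<in> pverts G"
      proof
        assume "(f u, f v) \<in> map_prod f f ` parcs G"
        then obtain x y where xy: "(x, y) \<in> parcs G" "f u = f x" "f v = f y" by auto
        then have "u = x" "v = y"
          using that inj G.in_arcsD1 G.in_arcsD2 by (meson inj_onD)+
        then show "(u, v) \<in> parcs G" using xy by simp
      qed (force intro: rev_image_eqI)
      then show "(u, v) \<in> parcs G \<longleftrightarrow> (u, v) \<in> A \<times> B \<union> B \<times> A"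
        unfolding arcs by (auto simp: A_def B_def dest: G.in_arcsD1 G.in_arcsD2)
    qed
    moreover have "A \<inter> B = {}" using disj by (auto simp: A_def B_def)
    ultimately show ?R using sub by blast
  next
    assume ?R
    then obtain A B where AB: "A \<subseteq> pverts G" "B \<subseteq> pverts G" "A \<inter> B = {}" "card A = q" "card B = b"
      "card (pverts G) = q + b + k" "parcs G = A \<times> B \<union> B \<times> A" by blast
    define C where "C = pverts G - (A \<union> B)"
    have finV: "finite A" "finite B" "finite C"
      using AB(1,2) G.pair_finite_verts by (auto simp: C_def intro: finite_subset)
    have "card C = k"
      using AB finV by (simp add: C_def card_Diff_subset card_Un_disjoint)
    then obtain f g h where f: "bij_betw f A Q" and g: "bij_betw g B R" and h: "bij_betw h C K"
      using finite_same_card_bij finV fin cards AB by metis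
    \<comment> \<open>The three pieces have disjoint images, so the glued map is a bijection; arcs
      depend only on its values on \<open>A\<close> and \<open>B\<close>.\<close>
    define F where "F v = (if v \<in> A then f v else if v \<in> B then g v else h v)" for v
    have FA: "bij_betw F A Q" using f by (subst bij_betw_cong[of _ _ f]) (auto simp: F_def)
    have FB: "bij_betw F B R" using g AB(3) by (subst bij_betw_cong[of _ _ g]) (auto simp: F_def)
    have FC: "bij_betw F C K" using h by (subst bij_betw_cong[of _ _ h]) (auto simp: F_def C_def)
    have "bij_betw F (A \<union> B \<union> C) (Q \<union> R \<union> K)"
      using FA FB FC disj by (intro bij_betw_combine) auto
    moreover have "A \<union> B \<union> C = pverts G" using AB by (auto simp: C_def)
    ultimately have "inj_on F (pverts G)" "F ` pverts G = Q \<union> R \<union> K"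
      by (auto simp: bij_betw_def)
    moreover have "map_prod F F ` parcs G = Q \<times> R \<union> R \<times> Q"
      using FA FB AB(7) by (simp add: bij_betw_def image_Un map_prod_surj_on)
    ultimately show ?L
      unfolding iff pverts_complete_bipartite_union parcs_complete_bipartite_union
        Q_def[symmetric] R_def[symmetric] K_def[symmetric]
      by (intro exI[of _ F]) simp
  qed
qed

section \<open>The entropy bound and the graphs that attain it\<close>

theorem theorem2:
  fixes G :: "'a pair_pre_digraph" and n m :: nat
  assumes "n \<ge> 2"
    and "1 \<le> m"
    and "int m \<le> \<lceil>real n / 2\<rceil> * \<lfloor>real n / 2\<rfloor>"
    and "pair_graph G"
    and "bipartite G"
    and "card (pverts G) = n"
    and "card (edges G) = m"
  shows "degree_entropy G \<ge> 1 + log 2 (sqrt (real m)) \<and>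
    (degree_entropy G = 1 + log 2 (sqrt (real m)) \<longleftrightarrow>
      (\<exists>q b. 0 < q \<and> 0 < b \<and> q * b = m \<and> q + b \<le> n \<and>
        digraph_iso (with_proj G)
          (with_proj (disjoint_union (complete_bipartite_graph q b)
            (edgeless_graph (n - q - b))))))"
proof -
  interpret G: pair_graph G by fact
  obtain U W where V: "pverts G = U \<union> W" "U \<inter> W = {}"
    and arcs: "parcs G \<subseteq> U \<times> W \<union> W \<times> U"
    using \<open>bipartite G\<close> by (auto simp: bipartite_def)
  have ne: "edges G \<noteq> {}" using assms(2,7) by auto
  note bip = degree_entropy_bipartition[OF \<open>pair_graph G\<close> V arcs ne, unfolded assms(7)]
  note ge = degree_entropy_bipartition_ge[OF \<open>pair_graph G\<close> V arcs ne, unfolded assms(7)]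
  have "\<exists>q b. 0 < q \<and> 0 < b \<and> q * b = m \<and> q + b \<le> n \<and>
        digraph_iso (with_proj G)
          (with_proj (disjoint_union (complete_bipartite_graph q b)
            (edgeless_graph (n - q - b))))"
    if eq: "degree_entropy G = 1 + log 2 (sqrt (real m))"
  proof -
    define E where "E = parcs G \<inter> U \<times> W"
    \<comment> \<open>\<open>A\<close> and \<open>B\<close> are the non-isolated vertices of the two
      parts; their sizes serve as \<open>q\<close> and \<open>b\<close>.\<close>
    define A where "A = Domain E"
    define B where "B = Range E"
    have E: "E = A \<times> B" using ge(2) eq by (simp add: E_def A_def B_def)
    have sub: "A \<subseteq> U" "B \<subseteq> W" by (auto simp: A_def B_def E_def)
    have "parcs G = E \<union> E\<inverse>" using arcs G.arcs_symmetric by (auto simp: E_def)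
    then have parcs: "parcs G = A \<times> B \<union> B \<times> A" using E by auto
    have mAB: "card A * card B = m"
      using bip(1) E by (metis E_def card_cartesian_product)
    then have pos: "0 < card A" "0 < card B" using assms(2) by (auto intro: Nat.gr0I)
    have disj: "A \<inter> B = {}" using sub V by auto
    have subV: "A \<subseteq> pverts G" "B \<subseteq> pverts G" using sub V by auto
    have "card A + card B = card (A \<union> B)"
      using disj pos by (simp add: card_Un_disjoint card_gt_0_iff)
    also have "\<dots> \<le> n"
      using subV G.pair_finite_verts assms(6) card_mono by (metis Un_least)
    finally have le: "card A + card B \<le> n" .
    then have "digraph_iso (with_proj G) (with_proj (disjoint_union
        (complete_bipartite_graph (card A) (card B)) (edgeless_graph (n - card A - card B))))"
      using parcs disj subV assms(6)
      by (subst digraph_iso_complete_bipartite_union_iff[OF \<open>pair_graph G\<close>]) auto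
    then show ?thesis using mAB pos le by blast
  qed
  moreover have "degree_entropy G = 1 + log 2 (sqrt (real m))"
    if iso: "digraph_iso (with_proj G) (with_proj (disjoint_union (complete_bipartite_graph q b)
            (edgeless_graph (n - q - b))))" for q b
  proof -
    obtain A B where AB: "A \<subseteq> pverts G" "B \<subseteq> pverts G" "A \<inter> B = {}"
        "parcs G = A \<times> B \<union> B \<times> A"
      using iso unfolding digraph_iso_complete_bipartite_union_iff[OF \<open>pair_graph G\<close>] by blast
    \<comment> \<open>The isomorphism brings its own sides, so the equality criterion is applied to
      the bipartition into \<open>A\<close> and its complement. The isolated vertices join
      \<open>B\<close> in \<open>C\<close>, and the arcs from \<open>A\<close> to \<open>C\<close>
      still form the product \<open>A \<times> B\<close>.\<close>
    define C where "C = pverts G - A"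
    have C: "pverts G = A \<union> C" "A \<inter> C = {}" "parcs G \<subseteq> A \<times> C \<union> C \<times> A"
      using AB by (auto simp: C_def)
    have "parcs G \<inter> A \<times> C = A \<times> B" using AB by (auto simp: C_def)
    moreover have "A \<times> B = Domain (A \<times> B) \<times> Range (A \<times> B)" by auto
    ultimately show ?thesis
      using degree_entropy_bipartition_ge(2)[OF \<open>pair_graph G\<close> C ne] assms(7) by simp
  qed
  ultimately show ?thesis using ge(1) by blast
qed

end
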